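(* Let $r\ge 1$, let $0<\tau_1<\cdots<\tau_r<\pi$ and $0<\rho<\pi$, and let $s_i=[\cos(\tau_i+\rho),\cos(\tau_i-\rho)]$ for $i\in\{1,\ldots,r\}$. Then the set of segments $\{s_1,\ldots,s_r\}$ is unisolvent for $\mathbb{P}_{r-1}$ if and only if $$\rho\notin\left\{\frac{k\pi}{j}\;:\; j,k\in\{1,\ldots,r\},\ j>k\right\}.$$ Moreover, in case of unisolvence, given data $\mu_i=\int_{s_i}f(x)\,\mathrm{d}x$, $i\in\{1,\ldots,r\}$, for $f\in L_\infty([-1,1])$, the unique polynomial $p_{r-1}=\sum_{j=0}^{r-1}a_jU_j\in\mathbb{P}_{r-1}$ with $\int_{s_i}p_{r-1}(x)\,\mathrm{d}x=\mu_i$ for all $i$ can be obtained from the nodal interpolant $q_{r-1}=\sum_{j=0}^{r-1}b_jU_j\in\mathbb{P}_{r-1}$ determined by $q_{r-1}(\cos\tau_i)=\mu_i/|s_i|$, $i\in\{1,\ldots,r\}$, by using the relation $$b_j=a_j\,\frac{\sin((j+1)\rho)}{(j+1)\sin(\rho)},\quad j\in\{0,\ldots,r-1\}.$$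
   Context: $\mathbb{P}_{n}$ denotes the space of real univariate polynomials of degree at most $n$. A set of $r$ segments $\{s_1,\ldots,s_r\}$ (nondegenerate closed intervals contained in $[-1,1]$) is called unisolvent for $\mathbb{P}_{r-1}$ if for every $(\mu_1,\ldots,\mu_r)\in\mathbb{R}^r$ there is a unique $p\in\mathbb{P}_{r-1}$ with $\int_{s_i} p(x)\,\mathrm{d}x = \mu_i$ for all $i$. $|s_i|$ is the length of $s_i$, here $|s_i|=2\sin(\tau_i)\sin(\rho)>0$. $U_j$ is the Chebyshev polynomial of the second kind of degree $j$, $U_j(\cos t)=\sin((j+1)t)/\sin t$. *)

theory Defs
  imports "HOL-Analysis.Analysis" "HOL-Computational_Algebra.Polynomial"
begin

definition poly_space :: "nat \<Rightarrow> real poly set" where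
  "poly_space n = {p. degree p \<le> n}"

definition segment :: "real set \<Rightarrow> bool" where
  "segment S \<longleftrightarrow> (\<exists>a b. -1 \<le> a \<and> a < b \<and> b \<le> 1 \<and> S = {a..b})"

(* The segments form a family indexed by {1..r}; if two of them coincide, the condition
   is read on the family, so that it fails. Meant for r >= 1, since r - 1 truncates at r = 0. *)
definition unisolvent :: "nat \<Rightarrow> (nat \<Rightarrow> real set) \<Rightarrow> bool" where
  "unisolvent r s \<longleftrightarrow>
     (\<forall>i\<in>{1..r}. segment (s i)) \<and>
     (\<forall>\<mu> :: nat \<Rightarrow> real. \<exists>!p. p \<in> poly_space (r - 1) \<and>
        (\<forall>i\<in>{1..r}. (LINT x:s i|lebesgue. poly p x) = \<mu> i))"

(* Representatives of the classes in the space of essentially bounded functions on [-1,1];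
   the values of f outside [-1,1] are irrelevant. *)
definition L_infinity :: "(real \<Rightarrow> real) set" where
  "L_infinity = {f. f \<in> borel_measurable (lebesgue_on {-1..1}) \<and>
     (\<exists>C. AE x in lebesgue_on {-1..1}. \<bar>f x\<bar> \<le> C)}"

fun cheb_U :: "nat \<Rightarrow> real poly" where
  "cheb_U 0 = 1"
| "cheb_U (Suc 0) = [:0, 2:]"
| "cheb_U (Suc (Suc n)) = [:0, 2:] * cheb_U (Suc n) - cheb_U n"

lemma cheb_U_cos_sin: "poly (cheb_U j) (cos t) * sin t = sin (real (j + 1) * t)"
proof (induction j rule: cheb_U.induct)
  case 1
  show ?case by simp
next
  case 2
  show ?case by (simp add: sin_double[of t, simplified])
next
  case (3 n)
  have "sin (real (n + 3) * t) + sin (real (n + 1) * t) = 2 * cos t * sin (real (n + 2) * t)"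
    using sin_add[of "real (n + 2) * t" t] sin_diff[of "real (n + 2) * t" t]
    by (simp add: algebra_simps)
  moreover have "poly (cheb_U (Suc (Suc n))) (cos t) * sin t =
      2 * cos t * (poly (cheb_U (Suc n)) (cos t) * sin t) - poly (cheb_U n) (cos t) * sin t"
    by (simp add: algebra_simps)
  ultimately show ?case using 3 by (simp add: algebra_simps)
qed

lemma cheb_U_cos: "sin t \<noteq> 0 \<Longrightarrow> poly (cheb_U j) (cos t) = sin (real (j + 1) * t) / sin t"
  using cheb_U_cos_sin[of j t] by (simp add: field_simps)

lemma degree_cheb_U: "degree (cheb_U j) = j"
proof (induction j rule: cheb_U.induct)
  case (3 n)
  have nz: "cheb_U (Suc n) \<noteq> 0" using 3 by (metis degree_0 nat.distinct(1))
  have d: "degree ([:0, 2:] * cheb_U (Suc n)) = Suc (Suc n)"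
    using 3 nz by (subst degree_mult_eq) auto
  have "degree (- cheb_U n) < degree ([:0, 2:] * cheb_U (Suc n))"
    unfolding d using 3 by simp
  then have "degree ([:0, 2:] * cheb_U (Suc n) + - cheb_U n) = Suc (Suc n)"
    using d by (metis degree_add_eq_left)
  then show ?case by simp
qed auto

end

theory Submission
  imports Defs
begin

text \<open>
  Averaging over the segments is a diagonal operator in the basis \<open>U\<^sub>0, U\<^sub>1, \<dots>\<close>.
  Substituting \<open>x = cos t\<close> turns the integral of \<open>U\<^sub>j\<close> over \<open>[cos (\<tau> + \<rho>), cos (\<tau> - \<rho>)]\<close> into the
  integral of \<open>sin ((j + 1) t)\<close> over an interval of radius \<open>\<rho>\<close> around \<open>\<tau>\<close>, which is a multiple of
  \<open>sin ((j + 1) \<tau>)\<close>. So the mean of \<open>U\<^sub>j\<close> over the segment is \<open>\<lambda>\<^sub>j U\<^sub>j (cos \<tau>)\<close> with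
  \<open>\<lambda>\<^sub>j = sin ((j + 1) \<rho>) / ((j + 1) sin \<rho>)\<close>, a factor that depends on \<open>\<rho>\<close> only and not on the
  segment (\<open>arc_segment_integral_cheb_U\<close>).

  Hence \<open>\<Sum> a\<^sub>j U\<^sub>j\<close> has the integrals \<open>\<mu>\<^sub>i\<close> if and only if \<open>\<Sum> a\<^sub>j \<lambda>\<^sub>j U\<^sub>j\<close> takes the values
  \<open>\<mu>\<^sub>i / |s\<^sub>i|\<close> at the nodes \<open>cos \<tau>\<^sub>i\<close>. These nodes are distinct, so that nodal interpolation is uniquely
  solvable (\<open>interpolation_unique_exists\<close>), and the \<open>U\<^sub>j\<close> with \<open>j < r\<close> form a basis of the polynomials of
  degree below \<open>r\<close> (\<open>cheb_expansion_exists\<close>, \<open>cheb_sum_eq_iff\<close>). The integral problem therefore reads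
  \<open>b\<^sub>j = a\<^sub>j \<lambda>\<^sub>j\<close> in coordinates, where \<open>b\<close> belongs to the nodal interpolant. It is uniquely solvable for
  all data exactly when no \<open>\<lambda>\<^sub>j\<close> with \<open>j < r\<close> vanishes, that is, when \<open>(j + 1) \<rho>\<close> is never a multiple
  of \<open>\<pi>\<close> (\<open>averaging_factor_eq_0_iff\<close>).
\<close>

section \<open>Chebyshev expansions\<close>

abbreviation cheb_sum :: "nat \<Rightarrow> (nat \<Rightarrow> real) \<Rightarrow> real poly" where
  "cheb_sum n a \<equiv> (\<Sum>j=0..n. smult (a j) (cheb_U j))"

lemma cheb_U_nonzero: "cheb_U j \<noteq> 0"
  by (cases j) (auto simp: degree_cheb_U dest: arg_cong[where f = degree])

lemma degree_cheb_sum: "degree (cheb_sum n a) \<le> n"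
  by (intro degree_sum_le) (auto intro: order_trans[OF degree_smult_le] simp: degree_cheb_U)

lemma coeff_cheb_sum_top:
  "coeff (cheb_sum n a) n = a n * lead_coeff (cheb_U n)"
proof -
  have "coeff (cheb_sum n a) n = (\<Sum>j=0..n. a j * coeff (cheb_U j) n)"
    by (simp add: coeff_sum)
  also have "\<dots> = (\<Sum>j=0..n. if j = n then a n * coeff (cheb_U n) n else 0)"
    by (intro sum.cong) (auto simp: coeff_eq_0 degree_cheb_U)
  finally show ?thesis by (simp add: degree_cheb_U)
qed

text \<open>
  \<open>U\<^sub>n\<close> has degree exactly \<open>n\<close>, so a suitable multiple of it cancels the coefficient of degree \<open>n\<close> and
  lowers the degree.
\<close>
lemma cheb_expansion_exists:
  assumes "degree p \<le> n"
  shows "\<exists>a. p = cheb_sum n a"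
  using assms
proof (induction n arbitrary: p)
  case 0
  then obtain c where "p = [:c:]" by (auto elim: degree_eq_zeroE)
  then show ?case by (intro exI[of _ "\<lambda>_. c"]) simp
next
  case (Suc n)
  define c where "c = coeff p (Suc n) / lead_coeff (cheb_U (Suc n))"
  define p' where "p' = p - smult c (cheb_U (Suc n))"
  have nz: "lead_coeff (cheb_U (Suc n)) \<noteq> 0"
    using cheb_U_nonzero leading_coeff_0_iff by blast
  have "degree p' \<le> Suc n"
    unfolding p'_def using Suc.prems
    by (intro degree_diff_le) (auto intro: order_trans[OF degree_smult_le] simp: degree_cheb_U)
  moreover have "coeff p' (Suc n) = 0"
    using nz by (simp add: p'_def c_def degree_cheb_U del: cheb_U.simps)
  ultimately have "degree p' \<le> n"
    by (metis degree_0 le_SucE le_0_eq leading_coeff_0_iff linear)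
  then obtain a where "p' = cheb_sum n a" using Suc.IH by blast
  then have "p = cheb_sum (Suc n) (a(Suc n := c))"
    by (simp add: p'_def algebra_simps del: cheb_U.simps)
  then show ?case by blast
qed

text \<open>
  Linear independence: only the last summand contributes to the coefficient of degree \<open>n\<close>, so the top
  coefficients agree, and the remaining ones follow by induction.
\<close>
lemma cheb_sum_eq_iff:
  "cheb_sum n a = cheb_sum n b \<longleftrightarrow> (\<forall>j\<in>{0..n}. a j = b j)"
proof
  show "cheb_sum n a = cheb_sum n b \<Longrightarrow> \<forall>j\<in>{0..n}. a j = b j"
  proof (induction n)
    case 0
    then show ?case by (metis atLeastAtMost_iff coeff_cheb_sum_top cheb_U_nonzero le_0_eq
          leading_coeff_0_iff mult_cancel_right)
  next
    case (Suc n)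
    have top: "a (Suc n) = b (Suc n)"
      using arg_cong[OF Suc.prems, of "\<lambda>p. coeff p (Suc n)"] cheb_U_nonzero[of "Suc n"]
      unfolding coeff_cheb_sum_top by simp
    with Suc.prems have "cheb_sum n a = cheb_sum n b"
      by (simp del: cheb_U.simps)
    with Suc.IH top show ?case by (auto simp: le_Suc_eq)
  qed
qed (auto intro: sum.cong)

lemma ex1_iff_eq:
  assumes "\<exists>!x. x \<in> A \<and> P x" "y \<in> A" "P y" "x \<in> A"
  shows "P x \<longleftrightarrow> y = x"
  using assms by auto

section \<open>Nodal interpolation\<close>

text \<open>
  Newton's construction: a new node is accommodated by adding a multiple of the polynomial that vanishes
  at all the old nodes. For the empty set of nodes the truncated bound is \<open>0\<close>, which still fits.
\<close>
lemma interpolation_exists: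
  fixes g :: "real \<Rightarrow> real"
  assumes "finite A"
  shows "\<exists>p. degree p \<le> card A - 1 \<and> (\<forall>x\<in>A. poly p x = g x)"
  using assms
proof (induction A)
  case empty
  show ?case by (intro exI[of _ 0]) simp
next
  case (insert x A)
  then obtain p where p: "degree p \<le> card A - 1" "\<forall>x\<in>A. poly p x = g x" by blast
  define w where "w = (\<Prod>y\<in>A. [:- y, 1:])"
  define c where "c = (g x - poly p x) / poly w x"
  have wx: "poly w x \<noteq> 0"
    using insert by (auto simp: w_def poly_prod)
  have wA: "\<forall>y\<in>A. poly w y = 0"
    using insert by (auto simp: w_def poly_prod)
  have "degree w = card A"
    unfolding w_def by (subst degree_prod_eq_sum_degree) auto
  then have "degree (p + smult c w) \<le> card A"
    using p(1) by (intro degree_add_le) (auto intro: order_trans[OF degree_smult_le])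
  moreover have "\<forall>y\<in>insert x A. poly (p + smult c w) y = g y"
    using p(2) wA wx by (auto simp: c_def)
  ultimately show ?case
    using insert by (intro exI[of _ "p + smult c w"]) auto
qed

lemma interpolation_unique_exists:
  fixes x y :: "nat \<Rightarrow> real"
  assumes "r \<ge> 1" and inj: "inj_on x {1..r}"
  shows "\<exists>!q. q \<in> poly_space (r - 1) \<and> (\<forall>i\<in>{1..r}. poly q (x i) = y i)"
proof -
  have card: "card (x ` {1..r}) = r"
    using card_image[OF inj] by simp
  obtain p where p: "degree p \<le> r - 1"
      "\<forall>z\<in>x ` {1..r}. poly p z = y (inv_into {1..r} x z)"
    using interpolation_exists[of "x ` {1..r}" "\<lambda>z. y (inv_into {1..r} x z)"] card by auto
  show ?thesis
  proof (rule ex1I[of _ p])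
    show "p \<in> poly_space (r - 1) \<and> (\<forall>i\<in>{1..r}. poly p (x i) = y i)"
      using p inv_into_f_f[OF inj] by (auto simp: poly_space_def)
  next
    fix q assume q: "q \<in> poly_space (r - 1) \<and> (\<forall>i\<in>{1..r}. poly q (x i) = y i)"
    show "q = p"
    proof (rule poly_eqI_degree[of "x ` {1..r}"])
      show "poly q z = poly p z" if "z \<in> x ` {1..r}" for z
        using that q p inv_into_f_f[OF inj] by auto
    qed (use q p card \<open>r \<ge> 1\<close> in \<open>auto simp: poly_space_def\<close>)
  qed
qed

section \<open>Integrals over arc segments\<close>

lemma set_integrable_poly_Icc: "set_integrable lebesgue {a..b} (poly (p :: real poly))"
  by (intro absolutely_integrable_continuous_real continuous_intros)

text \<open>
  The eigenvalue \<open>\<lambda>\<^sub>j\<close> of averaging over arc segments of angular radius \<open>\<rho>\<close>; \<open>U\<^sub>j\<close> is the eigenfunction.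
\<close>
definition averaging_factor :: "real \<Rightarrow> nat \<Rightarrow> real" where
  "averaging_factor \<rho> j = sin (real (j + 1) * \<rho>) / (real (j + 1) * sin \<rho>)"

lemma cos_diff_cos_sum: "cos (\<tau> - \<rho>) - cos (\<tau> + \<rho>) = 2 * sin \<tau> * sin (\<rho> :: real)"
  by (simp add: cos_add cos_diff)

lemma cos_arc_less:
  assumes "0 < \<tau>" "\<tau> < pi" "0 < \<rho>" "\<rho> < pi"
  shows "cos (\<tau> + \<rho>) < cos (\<tau> - \<rho>)"
  using cos_diff_cos_sum[of \<tau> \<rho>] sin_gt_zero[OF assms(1,2)] sin_gt_zero[OF assms(3,4)]
  by (metis diff_gt_0_iff_gt mult_pos_pos zero_less_numeral)

lemma measure_arc_segment:
  assumes "0 < \<tau>" "\<tau> < pi" "0 < \<rho>" "\<rho> < pi"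
  shows "measure lebesgue {cos (\<tau> + \<rho>)..cos (\<tau> - \<rho>)} = 2 * sin \<tau> * sin \<rho>"
  using cos_arc_less[OF assms] cos_diff_cos_sum[of \<tau> \<rho>] by simp

text \<open>
  Under \<open>x = cos t\<close> the integrand \<open>U\<^sub>j (x) dx\<close> becomes \<open>- sin ((j + 1) t) dt\<close>, which has an elementary
  antiderivative. The interval \<open>[\<tau> - \<rho>, \<tau> + \<rho>]\<close> may leave \<open>[0, \<pi>]\<close>, where the cosine is not
  monotone; the substitution is therefore used in the form that asks for no monotonicity and depends on
  the end points only.
\<close>
lemma arc_segment_integral_cheb_U:
  assumes "0 < \<tau>" "\<tau> < pi" "0 < \<rho>" "\<rho> < pi"
  shows "(LINT x:{cos (\<tau> + \<rho>)..cos (\<tau> - \<rho>)}|lebesgue. poly (cheb_U j) x) =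
    2 * sin \<tau> * sin \<rho> * (averaging_factor \<rho> j * poly (cheb_U j) (cos \<tau>))"
proof -
  let ?f = "poly (cheb_U j)" and ?m = "real (j + 1)"
  let ?I = "integral {cos (\<tau> + \<rho>)..cos (\<tau> - \<rho>)} ?f"
  \<comment> \<open>The substitution rule yields a difference of integrals in both orientations; one of them is void.\<close>
  have empty: "{cos (\<tau> - \<rho>)..cos (\<tau> + \<rho>)} = {}"
    using cos_arc_less[OF assms] by simp
  have "((\<lambda>t. - sin t *\<^sub>R ?f (cos t)) has_integral
      (integral {cos (\<tau> - \<rho>)..cos (\<tau> + \<rho>)} ?f - ?I)) {\<tau> - \<rho>..\<tau> + \<rho>}"
    by (rule has_integral_substitution_general[of "{}" _ _ _ "-1" 1])
      (use \<open>0 < \<rho>\<close> in \<open>auto intro!: continuous_intros derivative_eq_intros\<close>)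
  then have subst: "((\<lambda>t. - sin (?m * t)) has_integral - ?I) {\<tau> - \<rho>..\<tau> + \<rho>}"
    unfolding empty using cheb_U_cos_sin[of j] by (simp add: mult.commute)
  have "((\<lambda>t. - sin (?m * t)) has_integral
      (cos (?m * (\<tau> + \<rho>)) / ?m - cos (?m * (\<tau> - \<rho>)) / ?m)) {\<tau> - \<rho>..\<tau> + \<rho>}"
    by (rule fundamental_theorem_of_calculus)
      (use \<open>0 < \<rho>\<close> in \<open>auto simp flip: has_real_derivative_iff_has_vector_derivative
         intro!: derivative_eq_intros\<close>)
  with subst have "?I = (cos (?m * (\<tau> - \<rho>)) - cos (?m * (\<tau> + \<rho>))) / ?m"
    by (smt (verit) diff_divide_distrib has_integral_unique)
  also have "\<dots> = 2 * sin (?m * \<tau>) * sin (?m * \<rho>) / ?m"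
    using cos_diff_cos_sum[of "?m * \<tau>" "?m * \<rho>"] by (simp add: algebra_simps)
  also have "\<dots> = 2 * sin \<tau> * sin \<rho> * (averaging_factor \<rho> j * ?f (cos \<tau>))"
    using sin_gt_zero[OF assms(3,4)]
    unfolding cheb_U_cos_sin[of j \<tau>, symmetric] averaging_factor_def by simp
  finally show ?thesis
    using set_lebesgue_integral_eq_integral(2)[OF set_integrable_poly_Icc] by simp
qed

text \<open>
  By linearity, averaging over the segment amounts to multiplying the Chebyshev coefficients by the
  averaging factors and evaluating at a single point.
\<close>
lemma arc_segment_integral_cheb_sum:
  assumes "0 < \<tau>" "\<tau> < pi" "0 < \<rho>" "\<rho> < pi"
  shows "(LINT x:{cos (\<tau> + \<rho>)..cos (\<tau> - \<rho>)}|lebesgue. poly (cheb_sum n a) x) =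
    measure lebesgue {cos (\<tau> + \<rho>)..cos (\<tau> - \<rho>)} *
      poly (cheb_sum n (\<lambda>j. a j * averaging_factor \<rho> j)) (cos \<tau>)"
proof -
  let ?S = "{cos (\<tau> + \<rho>)..cos (\<tau> - \<rho>)}"
  have int: "set_integrable lebesgue ?S (\<lambda>x. a j * poly (cheb_U j) x)" for j
    by (intro absolutely_integrable_continuous_real continuous_intros)
  have "(LINT x:?S|lebesgue. poly (cheb_sum n a) x)
      = (LINT x:?S|lebesgue. (\<Sum>j=0..n. a j * poly (cheb_U j) x))"
    by (simp add: poly_sum)
  also have "\<dots> = (\<Sum>j=0..n. LINT x:?S|lebesgue. a j * poly (cheb_U j) x)"
    unfolding set_lebesgue_integral_def
    by (simp only: scaleR_sum_right, rule Bochner_Integration.integral_sum)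
       (use int in \<open>simp add: set_integrable_def\<close>)
  also have "\<dots> = (\<Sum>j=0..n. 2 * sin \<tau> * sin \<rho> *
      (a j * averaging_factor \<rho> j * poly (cheb_U j) (cos \<tau>)))"
    by (simp add: arc_segment_integral_cheb_U[OF assms] mult_ac)
  finally show ?thesis
    unfolding measure_arc_segment[OF assms] by (simp add: poly_sum sum_distrib_left)
qed

section \<open>Unisolvence\<close>

text \<open>
  The zeros of the sine are the integer multiples of \<open>\<pi>\<close>, and \<open>0 < (j + 1) \<rho> < (j + 1) \<pi>\<close> confines
  the multiple to \<open>1, \<dots>, j\<close>.
\<close>
lemma averaging_factor_eq_0_iff:
  assumes "0 < \<rho>" "\<rho> < pi"
  shows "averaging_factor \<rho> j = 0 \<longleftrightarrow>
    (\<exists>k. 1 \<le> k \<and> k < j + 1 \<and> \<rho> = real k * pi / real (j + 1))"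
proof -
  have "averaging_factor \<rho> j = 0 \<longleftrightarrow> sin (real (j + 1) * \<rho>) = 0"
    using sin_gt_zero[OF assms] by (simp add: averaging_factor_def del: of_nat_add of_nat_Suc)
  also have "\<dots> \<longleftrightarrow> (\<exists>k. 1 \<le> k \<and> k < j + 1 \<and> \<rho> = real k * pi / real (j + 1))"
  proof
    assume "sin (real (j + 1) * \<rho>) = 0"
    then obtain i :: int where i: "real (j + 1) * \<rho> = of_int i * pi"
      using sin_zero_iff_int2 by blast
    have "0 < of_int i * pi"
      using assms unfolding i[symmetric] by (intro mult_pos_pos) auto
    then have pos: "0 < i" by (simp add: zero_less_mult_iff)
    have "of_int i * pi < real (j + 1) * pi"
      using assms unfolding i[symmetric] by (intro mult_strict_left_mono) auto
    then have "of_int i < real (j + 1)" by (simp only: mult_less_cancel_right_pos[OF pi_gt_zero])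
    then have "i < int (j + 1)" by linarith
    moreover have "\<rho> = of_int i * pi / real (j + 1)"
      using i by (simp add: field_simps)
    ultimately show "\<exists>k. 1 \<le> k \<and> k < j + 1 \<and> \<rho> = real k * pi / real (j + 1)"
      using pos by (intro exI[of _ "nat i"]) auto
  next
    assume "\<exists>k. 1 \<le> k \<and> k < j + 1 \<and> \<rho> = real k * pi / real (j + 1)"
    then obtain k where "\<rho> = real k * pi / real (j + 1)" by blast
    then have "real (j + 1) * \<rho> = real k * pi" by simp
    then show "sin (real (j + 1) * \<rho>) = 0" by (simp only: sin_npi)
  qed
  finally show ?thesis .
qed

lemma no_averaging_factor_vanishes_iff:
  assumes "r \<ge> 1" "0 < \<rho>" "\<rho> < pi"
  shows "(\<forall>j\<in>{0..r-1}. averaging_factor \<rho> j \<noteq> 0) \<longleftrightarrow>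
    \<rho> \<notin> {real k * pi / real j | j k. j \<in> {1..r} \<and> k \<in> {1..r} \<and> j > k}" (is "?L \<longleftrightarrow> ?R")
proof
  assume L: ?L
  show ?R
  proof
    assume "\<rho> \<in> {real k * pi / real j | j k. j \<in> {1..r} \<and> k \<in> {1..r} \<and> j > k}"
    then obtain j k where jk: "\<rho> = real k * pi / real j" "j \<in> {1..r}" "k \<in> {1..r}" "j > k"
      by blast
    then have "averaging_factor \<rho> (j - 1) = 0"
      using averaging_factor_eq_0_iff[OF assms(2,3), of "j - 1"] by auto
    moreover have "j - 1 \<in> {0..r-1}" using jk by auto
    ultimately show False using L by blast
  qed
next
  assume R: ?R
  show ?L
  proof
    fix j assume j: "j \<in> {0..r-1}"
    show "averaging_factor \<rho> j \<noteq> 0"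
    proof
      assume "averaging_factor \<rho> j = 0"
      then obtain k where k: "1 \<le> k" "k < j + 1" "\<rho> = real k * pi / real (j + 1)"
        using averaging_factor_eq_0_iff[OF assms(2,3)] by blast
      have "j + 1 \<in> {1..r}" "k \<in> {1..r}" using j k \<open>r \<ge> 1\<close> by auto
      with k R show False by blast
    qed
  qed
qed

theorem proposition3p4:
  fixes r :: nat and \<tau> :: "nat \<Rightarrow> real" and \<rho> :: real and s :: "nat \<Rightarrow> real set"
  assumes "r \<ge> 1"
    and "\<forall>i\<in>{1..r}. 0 < \<tau> i \<and> \<tau> i < pi"
    and "strict_mono_on {1..r} \<tau>"
    and "0 < \<rho>" and "\<rho> < pi"
    and "\<forall>i\<in>{1..r}. s i = {cos (\<tau> i + \<rho>)..cos (\<tau> i - \<rho>)}"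
  shows "(unisolvent r s \<longleftrightarrow>
      \<rho> \<notin> {real k * pi / real j | j k. j \<in> {1..r} \<and> k \<in> {1..r} \<and> j > k}) \<and>
    (unisolvent r s \<longrightarrow>
      (\<forall>f \<mu>. f \<in> L_infinity \<and> (\<forall>i\<in>{1..r}. \<mu> i = (LINT x:s i|lebesgue. f x)) \<longrightarrow>
        (\<exists>!p. p \<in> poly_space (r - 1) \<and>
           (\<forall>i\<in>{1..r}. (LINT x:s i|lebesgue. poly p x) = \<mu> i)) \<and>
        (\<exists>!q. q \<in> poly_space (r - 1) \<and>
           (\<forall>i\<in>{1..r}. poly q (cos (\<tau> i)) = \<mu> i / measure lebesgue (s i))) \<and>
        (\<forall>p q.
           p \<in> poly_space (r - 1) \<and>
           (\<forall>i\<in>{1..r}. (LINT x:s i|lebesgue. poly p x) = \<mu> i) \<and>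
           q \<in> poly_space (r - 1) \<and>
           (\<forall>i\<in>{1..r}. poly q (cos (\<tau> i)) = \<mu> i / measure lebesgue (s i)) \<longrightarrow>
           (\<exists>a. p = (\<Sum>j=0..r-1. smult (a j) (cheb_U j))) \<and>
           (\<exists>b. q = (\<Sum>j=0..r-1. smult (b j) (cheb_U j))) \<and>
           (\<forall>a b. q = (\<Sum>j=0..r-1. smult (b j) (cheb_U j)) \<longrightarrow>
              (p = (\<Sum>j=0..r-1. smult (a j) (cheb_U j)) \<longleftrightarrow>
               (\<forall>j\<in>{0..r-1}.
                  b j = a j * (sin (real (j + 1) * \<rho>) / (real (j + 1) * sin \<rho>))))))))"
proof -
  let ?P = "poly_space (r - 1)"
  let ?int = "\<lambda>p \<mu>. \<forall>i\<in>{1..r}. (LINT x:s i|lebesgue. poly p x) = \<mu> i"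
  let ?nod = "\<lambda>q \<mu>. \<forall>i\<in>{1..r}. poly q (cos (\<tau> i)) = \<mu> i / measure lebesgue (s i)"
  let ?av = "\<lambda>a j. a j * averaging_factor \<rho> j"

  have angles: "0 < \<tau> i" "\<tau> i < pi" if "i \<in> {1..r}" for i
    using assms(2) that by auto
  have s_eq: "s i = {cos (\<tau> i + \<rho>)..cos (\<tau> i - \<rho>)}" if "i \<in> {1..r}" for i
    using assms(6) that by blast
  have in_P: "cheb_sum (r - 1) a \<in> ?P" for a
    using degree_cheb_sum by (simp add: poly_space_def)
  have expand: "\<exists>a. p = cheb_sum (r - 1) a" if "p \<in> ?P" for p
    using cheb_expansion_exists that by (simp add: poly_space_def)
  have measure_pos: "measure lebesgue (s i) > 0" if "i \<in> {1..r}" for i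
    using measure_arc_segment[OF angles[OF that] assms(4,5)]
      sin_gt_zero[OF angles[OF that]] sin_gt_zero[OF assms(4,5)] s_eq[OF that] by simp
  have segments: "\<forall>i\<in>{1..r}. segment (s i)"
  proof
    fix i assume i: "i \<in> {1..r}"
    show "segment (s i)"
      unfolding segment_def s_eq[OF i]
      using cos_arc_less[OF angles[OF i] assms(4,5)] cos_ge_minus_one cos_le_one by blast
  qed

  have nodes_inj: "inj_on (\<lambda>i. cos (\<tau> i)) {1..r}"
  proof (rule inj_onI)
    fix i k assume ik: "i \<in> {1..r}" "k \<in> {1..r}" "cos (\<tau> i) = cos (\<tau> k)"
    have "\<tau> i = \<tau> k"
      using angles[OF ik(1)] angles[OF ik(2)] ik(3) by (intro cos_inj_pi[of "\<tau> i" "\<tau> k"]) auto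
    then show "i = k"
      using inj_onD[OF strict_mono_on_imp_inj_on[OF assms(3)] _ ik(1,2)] by blast
  qed
  have nodal: "\<exists>!q. q \<in> ?P \<and> ?nod q \<mu>" for \<mu>
    by (rule interpolation_unique_exists[OF assms(1) nodes_inj])

  \<comment> \<open>Segment data for a polynomial are the same as nodal data for its averaged polynomial.\<close>
  have transfer: "?int (cheb_sum (r - 1) a) \<mu> \<longleftrightarrow> ?nod (cheb_sum (r - 1) (?av a)) \<mu>" for a \<mu>
  proof (rule ball_cong[OF refl])
    fix i assume i: "i \<in> {1..r}"
    have "(LINT x:s i|lebesgue. poly (cheb_sum (r - 1) a) x) =
        measure lebesgue (s i) * poly (cheb_sum (r - 1) (?av a)) (cos (\<tau> i))"
      unfolding s_eq[OF i] by (rule arc_segment_integral_cheb_sum[OF angles[OF i] assms(4,5)])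
    then show "(LINT x:s i|lebesgue. poly (cheb_sum (r - 1) a) x) = \<mu> i \<longleftrightarrow>
        poly (cheb_sum (r - 1) (?av a)) (cos (\<tau> i)) = \<mu> i / measure lebesgue (s i)"
      using measure_pos[OF i] by (auto simp: field_simps)
  qed
  \<comment> \<open>In coordinates the integral problem is a diagonal linear system whose right-hand side \<open>b\<close> is the
    nodal interpolant.\<close>
  have solves_iff: "?int (cheb_sum (r - 1) a) \<mu> \<longleftrightarrow> (\<forall>j\<in>{0..r-1}. b j = ?av a j)"
    if b: "?nod (cheb_sum (r - 1) b) \<mu>" for a b \<mu>
  proof -
    have "?nod (cheb_sum (r - 1) (?av a)) \<mu> \<longleftrightarrow> cheb_sum (r - 1) b = cheb_sum (r - 1) (?av a)"
      by (rule ex1_iff_eq[OF nodal[of \<mu>] in_P b in_P])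
    then show ?thesis
      unfolding transfer cheb_sum_eq_iff .
  qed

  have unique_sol: "\<exists>!p. p \<in> ?P \<and> ?int p \<mu>" if "unisolvent r s" for \<mu>
    using that unfolding unisolvent_def by blast

  have unisolvent_iff: "unisolvent r s \<longleftrightarrow> (\<forall>j\<in>{0..r-1}. averaging_factor \<rho> j \<noteq> 0)"
  proof
    assume uni: "unisolvent r s"
    show "\<forall>j\<in>{0..r-1}. averaging_factor \<rho> j \<noteq> 0"
    proof (intro ballI notI)
      fix j assume j: "j \<in> {0..r-1}" "averaging_factor \<rho> j = 0"
      \<comment> \<open>If \<open>\<lambda>\<^sub>j = 0\<close>, then \<open>U\<^sub>j\<close> has the same integrals as the zero polynomial.\<close>
      have zero: "?nod (cheb_sum (r - 1) (\<lambda>_. 0)) (\<lambda>_. 0)" by simp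
      have int: "?int (cheb_sum (r - 1) (\<lambda>i. if i = j then 1 else 0)) (\<lambda>_. 0)"
        "?int (cheb_sum (r - 1) (\<lambda>_. 0)) (\<lambda>_. 0)"
        unfolding solves_iff[OF zero] using j by auto
      have "cheb_sum (r - 1) (\<lambda>i. if i = j then 1 else 0) = cheb_sum (r - 1) (\<lambda>_. 0)"
        by (rule ex1_iff_eq[OF unique_sol[OF uni, of "\<lambda>_. 0"] in_P int(1) in_P, THEN iffD1, OF int(2)])
      from bspec[OF this[unfolded cheb_sum_eq_iff] j(1)] show False
        by simp
    qed
  next
    assume nz: "\<forall>j\<in>{0..r-1}. averaging_factor \<rho> j \<noteq> 0"
    have "\<exists>!p. p \<in> ?P \<and> ?int p \<mu>" for \<mu>
    proof -
      obtain b where b: "?nod (cheb_sum (r - 1) b) \<mu>"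
        using ex1_implies_ex[OF nodal[of \<mu>]] expand by blast
      define a where "a j = b j / averaging_factor \<rho> j" for j
      show ?thesis
      proof (rule ex1I[of _ "cheb_sum (r - 1) a"])
        show "cheb_sum (r - 1) a \<in> ?P \<and> ?int (cheb_sum (r - 1) a) \<mu>"
          using in_P solves_iff[OF b] nz by (simp add: a_def)
      next
        fix p assume p: "p \<in> ?P \<and> ?int p \<mu>"
        then obtain a' where a': "p = cheb_sum (r - 1) a'" using expand by blast
        then have "\<forall>j\<in>{0..r-1}. b j = ?av a' j"
          using p solves_iff[OF b] by blast
        then show "p = cheb_sum (r - 1) a"
          unfolding a' cheb_sum_eq_iff using nz by (simp add: a_def)
      qed
    qed
    with segments show "unisolvent r s" unfolding unisolvent_def by blast
  qed

  have relation: "p = cheb_sum (r - 1) a \<longleftrightarrow> (\<forall>j\<in>{0..r-1}.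
      b j = a j * (sin (real (j + 1) * \<rho>) / (real (j + 1) * sin \<rho>)))"
    if "unisolvent r s" "p \<in> ?P" "?int p \<mu>" "?nod q \<mu>" "q = cheb_sum (r - 1) b" for p q a b \<mu>
  proof -
    have "p = cheb_sum (r - 1) a \<longleftrightarrow> ?int (cheb_sum (r - 1) a) \<mu>"
      using ex1_iff_eq[OF unique_sol[OF that(1), of \<mu>] that(2,3) in_P] by (rule sym)
    also have "\<dots> \<longleftrightarrow> (\<forall>j\<in>{0..r-1}. b j = ?av a j)"
      using solves_iff that(4,5) by blast
    finally show ?thesis unfolding averaging_factor_def .
  qed
  show ?thesis
  proof (intro conjI impI allI)
    show "unisolvent r s \<longleftrightarrow>
        \<rho> \<notin> {real k * pi / real j | j k. j \<in> {1..r} \<and> k \<in> {1..r} \<and> j > k}"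
      unfolding unisolvent_iff by (rule no_averaging_factor_vanishes_iff[OF assms(1,4,5)])
  next
    fix \<mu> :: "nat \<Rightarrow> real"
    assume uni: "unisolvent r s"
    show "\<exists>!p. p \<in> ?P \<and> ?int p \<mu>" by (rule unique_sol[OF uni])
    show "\<exists>!q. q \<in> ?P \<and> ?nod q \<mu>" by (rule nodal)
    fix p q assume sol: "p \<in> ?P \<and> ?int p \<mu> \<and> q \<in> ?P \<and> ?nod q \<mu>"
    show "\<exists>a. p = cheb_sum (r - 1) a" by (rule expand[OF conjunct1[OF sol]])
    show "\<exists>b. q = cheb_sum (r - 1) b"
      by (rule expand[OF conjunct1[OF conjunct2[OF conjunct2[OF sol]]]])
    fix a b :: "nat \<Rightarrow> real" assume q: "q = cheb_sum (r - 1) b"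
    show "p = cheb_sum (r - 1) a \<longleftrightarrow> (\<forall>j\<in>{0..r-1}.
        b j = a j * (sin (real (j + 1) * \<rho>) / (real (j + 1) * sin \<rho>)))"
      by (rule relation[OF uni _ _ _ q]) (use sol in auto)
  qed
qed

end
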